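(* Let $MZ2$ denote the second multiplicative Zagreb index of a tree, and write $MZ2(n)=MZ2(\tau(n))$, where $\tau(n)$ is the rooted tree with Matula number $n$. Then for every positive integer $n$, $$MZ2(n)=\begin{cases}0, & \text{if } n=1;\\ 1, & \text{if } n=2;\\ \dfrac{MZ2(t)}{\Omega(t)^{\Omega(t)}}\,(1+\Omega(t))^{1+\Omega(t)}, & \text{if } n=p_t \text{ with } t\ge 2;\\ \dfrac{MZ2(r)\,MZ2(s)\,\Omega(n)^{\Omega(n)}}{\Omega(r)^{\Omega(r)}\,\Omega(s)^{\Omega(s)}}, & \text{if } n=rs \text{ with } r,s\ge 2.\end{cases}$$
   Context: For $m\ge 1$ let $p_m$ denote the $m$-th prime ($p_1=2,p_2=3,p_3=5,\dots$). For a positive integer $n$, $\Omega(n)$ is the number of prime divisors of $n$ counted with multiplicity. Rooted trees are finite and considered up to isomorphism of rooted trees. The Matula number $\mu(T)$ of a rooted tree $T$ is defined recursively: $\mu(T)=1$ for the one-vertex tree; otherwise, if $T_1,\dots,T_d$ are the subtrees rooted at the vertices adjacent to the root of $T$, then $\mu(T)=p_{\mu(T_1)}p_{\mu(T_2)}\cdots p_{\mu(T_d)}$. The map $\mu$ is a bijection from rooted trees to positive integers, and $\tau(n)$ denotes the rooted tree with Matula number $n$. Equivalently: $\tau(1)$ is the one-vertex tree; $\tau(p_t)$ is obtained from $\tau(t)$ by adding a new vertex, which becomes the root, joined by an edge to the root of $\tau(t)$; and, for $r,s\ge 2$, $\tau(rs)$ is obtained from $\tau(r)$ and $\tau(s)$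 by identifying their roots. For a statistic $S$ on rooted trees, $S(n)$ means $S(\tau(n))$. The degree $\deg(i)$ of a vertex $i$ is the number of edges incident with $i$. The second multiplicative Zagreb index of a tree with at least two vertices is $\prod_{ij} \deg(i)\deg(j)$, the product being over all edges $ij$. For the one-vertex tree (which has no edges) the index is taken to be $0$ by convention. *)

theory Defs
  imports
    Complex_Main
    "HOL-Library.Infinite_Set"
    "HOL-Computational_Algebra.Primes"
begin

text \<open>The library function \<^const>\<open>enumerate\<close> counts from \<open>0\<close>, whereas \<open>p\<^sub>1 = 2\<close>.\<close>

definition nth_prime :: "nat \<Rightarrow> nat"
  where "nth_prime m = enumerate {p. prime p} (m - 1)"

definition bigomega :: "nat \<Rightarrow> nat"
  where "bigomega n = size (prime_factorization n)"

text \<open>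
  Undirected simple graphs with a distinguished vertex; an edge is a two-element set of vertices.
  The predicate \<open>tree\<close> of the entry Graph_Theory of the Archive of Formal Proofs only excludes
  directed cycles and is therefore not the notion wanted here.
\<close>

record 'a rooted_graph =
  verts :: "'a set"
  edges :: "'a set set"
  root  :: 'a

definition wf_rooted_graph :: "'a rooted_graph \<Rightarrow> bool"
  where "wf_rooted_graph G \<longleftrightarrow>
    finite (verts G) \<and> root G \<in> verts G \<and> (\<forall>e\<in>edges G. e \<subseteq> verts G \<and> card e = 2)"

definition connected_graph :: "'a rooted_graph \<Rightarrow> bool"
  where "connected_graph G \<longleftrightarrow>
    (\<forall>u\<in>verts G. \<forall>v\<in>verts G. (u, v) \<in> {(x, y). {x, y} \<in> edges G}\<^sup>*)"

definition is_cycle :: "'a rooted_graph \<Rightarrow> 'a list \<Rightarrow> bool"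
  where "is_cycle G xs \<longleftrightarrow>
    length xs \<ge> 3 \<and> distinct xs \<and> set xs \<subseteq> verts G \<and>
    (\<forall>i. Suc i < length xs \<longrightarrow> {xs ! i, xs ! Suc i} \<in> edges G) \<and>
    {last xs, hd xs} \<in> edges G"

definition rooted_tree :: "'a rooted_graph \<Rightarrow> bool"
  where "rooted_tree T \<longleftrightarrow> wf_rooted_graph T \<and> connected_graph T \<and> (\<nexists>xs. is_cycle T xs)"

definition degree :: "'a rooted_graph \<Rightarrow> 'a \<Rightarrow> nat"
  where "degree G v = card {e \<in> edges G. v \<in> e}"

definition root_neighbours :: "'a rooted_graph \<Rightarrow> 'a set"
  where "root_neighbours T = {v. {root T, v} \<in> edges T}"

text \<open>
  The subtree of \<open>T\<close> rooted at a neighbour \<open>v\<close> of the root: the component of \<open>v\<close> after the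
  root has been deleted.
\<close>

definition branch_verts :: "'a rooted_graph \<Rightarrow> 'a \<Rightarrow> 'a set"
  where "branch_verts T v =
    {u. (v, u) \<in> {(x, y). {x, y} \<in> edges T \<and> x \<noteq> root T \<and> y \<noteq> root T}\<^sup>*}"

definition branch :: "'a rooted_graph \<Rightarrow> 'a \<Rightarrow> 'a rooted_graph"
  where "branch T v =
    \<lparr>verts = branch_verts T v, edges = {e \<in> edges T. e \<subseteq> branch_verts T v}, root = v\<rparr>"

lemma branch_verts_psubset:
  assumes "wf_rooted_graph T" "v \<in> root_neighbours T"
  shows "branch_verts T v \<subset> verts T"
proof -
  have e: "e \<subseteq> verts T" "card e = 2" if "e \<in> edges T" for e
    using assms(1) that by (auto simp: wf_rooted_graph_def)
  have v: "{root T, v} \<in> edges T"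
    using assms(2) by (simp add: root_neighbours_def)
  have neq: "v \<noteq> root T"
    using e(2)[OF v] by auto
  have "u \<in> verts T \<and> u \<noteq> root T" if "u \<in> branch_verts T v" for u
    using that unfolding branch_verts_def mem_Collect_eq
  proof (induction rule: rtrancl_induct)
    case base
    then show ?case using e(1)[OF v] neq by auto
  next
    case (step x y)
    then show ?case using e(1) by auto
  qed
  moreover have "root T \<in> verts T"
    using assms(1) by (simp add: wf_rooted_graph_def)
  ultimately show ?thesis by auto
qed

text \<open>
  The empty product gives the value \<open>1\<close> for the one-vertex tree. The value \<open>0\<close> for graphs that
  are not trees is never a Matula number of a tree; the case distinction is there to make the
  recursion terminate.
\<close>

function matula :: "'a rooted_graph \<Rightarrow> nat"
  where "matula T =
    (if rooted_tree T then \<Prod>v\<in>root_neighbours T. nth_prime (matula (branch T v)) else 0)"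
  by auto
termination
proof (relation "measure (\<lambda>T. card (verts T))", goal_cases)
  case 1
  then show ?case by simp
next
  case (2 T v)
  then have wf: "wf_rooted_graph T" by (simp add: rooted_tree_def)
  then have "card (branch_verts T v) < card (verts T)"
    using branch_verts_psubset[OF wf 2(2)]
    by (intro psubset_card_mono) (auto simp: wf_rooted_graph_def)
  then show ?case by (simp add: branch_def)
qed

declare matula.simps [simp del]

text \<open>
  A representative, with natural numbers as vertices, of the isomorphism class of rooted trees
  with Matula number \<open>n\<close>.
\<close>

definition tau :: "nat \<Rightarrow> nat rooted_graph"
  where "tau n = (SOME T. rooted_tree T \<and> matula T = n)"

definition zagreb2 :: "'a rooted_graph \<Rightarrow> nat"
  where "zagreb2 T =
    (if card (verts T) = 1 then 0 else \<Prod>e\<in>edges T. \<Prod>i\<in>e. degree T i)"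

definition MZ2 :: "nat \<Rightarrow> nat"
  where "MZ2 n = zagreb2 (tau n)"

end

theory Submission
  imports Defs
begin

text \<open>
  Grouping the factors of the index by vertices instead of edges, every vertex \<open>v\<close> of degree \<open>d\<close>
  contributes \<open>d\<close> factors \<open>d\<close>, so for a tree with at least two vertices the index is the product
  of all \<open>d ^ d\<close> (\<open>prod_edges_eq_prod_verts\<close>). The degree of the root is the number of prime
  factors of the Matula number, hence the root accounts for \<open>\<Omega>(n) ^ \<Omega>(n)\<close>. The remaining factor,
  the weight of the vertices other than the root, is multiplicative over the branches. Inside a
  branch all degrees are unchanged, except that the root of the branch, now joined to
  the root of the whole tree, has one more neighbour. A branch with Matula number \<open>m\<close> therefore
  multiplies the weight by \<open>(1 + \<Omega>(m)) ^ (1 + \<Omega>(m))\<close> times its own weight.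

  These rules determine the weight from \<open>n\<close> alone: it is the completely multiplicative function
  \<open>nonroot_weight\<close>, whose value at the prime \<open>p\<^sub>m\<close> is the contribution of a branch with Matula
  number \<open>m\<close>. By \<open>nonroot_weight_matula\<close> this holds for every tree with Matula number \<open>n\<close>, so
  trees with the same Matula number have the same index. Since every positive integer is a Matula
  number (\<open>matula_surj\<close>), \<open>tau n\<close> is such a tree for every \<open>n \<ge> 1\<close>. The recursion is
  then multiplicativity of \<open>nonroot_weight\<close>, with the factors \<open>\<Omega> ^ \<Omega>\<close> of the roots
  divided out and put back.
\<close>

section \<open>Enumeration of the primes and the number of prime divisors\<close>

lemma prime_nth_prime: "prime (nth_prime m)"
  using enumerate_in_set[OF primes_infinite, of "m - 1"] by (simp add: nth_prime_def)

lemma inj_on_nth_prime: "inj_on nth_prime {1..}"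
proof (rule inj_onI)
  fix a b assume "a \<in> {1..}" "b \<in> {1..}" "nth_prime a = nth_prime b"
  moreover have "inj (enumerate {p::nat. prime p})"
    by (intro strict_mono_imp_inj_on strict_mono_enumerate primes_infinite)
  ultimately show "a = b"
    unfolding nth_prime_def inj_def by (metis atLeast_iff le_add_diff_inverse)
qed

lemma nth_prime_surj:
  assumes "prime p"
  obtains m where "m \<ge> 1" "nth_prime m = p"
proof -
  obtain k where "enumerate {p::nat. prime p} k = p"
    using assms enumerate_Ex[OF primes_infinite] by auto
  then show ?thesis
    using that[of "Suc k"] by (simp add: nth_prime_def)
qed

text \<open>
  Indices are smaller than the primes they name. This makes recursion along Matula numbers
  terminate.
\<close>

lemma less_nth_prime: "m < nth_prime m"
proof -
  have "k + 2 \<le> enumerate {p::nat. prime p} k" for k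
  proof (induction k)
    case 0
    have "prime (enumerate {p::nat. prime p} 0)"
      using prime_nth_prime[of 1] by (simp add: nth_prime_def)
    then show ?case by (auto dest: prime_ge_2_nat)
  next
    case (Suc k)
    then show ?case
      using enumerate_step[OF primes_infinite, of k] by simp
  qed
  from this[of "m - 1"] show ?thesis unfolding nth_prime_def by linarith
qed

text \<open>
  The inverse is taken on the positive integers because \<open>nth_prime 0\<close> and \<open>nth_prime 1\<close> coincide.
\<close>

definition prime_index :: "nat \<Rightarrow> nat"
  where "prime_index = inv_into {1..} nth_prime"

lemma prime_index_nth_prime: "m \<ge> 1 \<Longrightarrow> prime_index (nth_prime m) = m"
  unfolding prime_index_def by (rule inv_into_f_f[OF inj_on_nth_prime]) simp

lemma prime_index_less: "prime p \<Longrightarrow> prime_index p < p"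
  by (metis nth_prime_surj prime_index_nth_prime less_nth_prime)

lemma bigomega_nth_prime: "bigomega (nth_prime m) = 1"
  by (simp add: bigomega_def prime_factorization_prime prime_nth_prime)

lemma bigomega_mult: "a > 0 \<Longrightarrow> b > 0 \<Longrightarrow> bigomega (a * b) = bigomega a + bigomega b"
  by (simp add: bigomega_def prime_factorization_mult)

lemma bigomega_prod_nth_prime:
  "finite A \<Longrightarrow> bigomega (\<Prod>v\<in>A. nth_prime (f v)) = card A"
proof (induction A rule: finite_induct)
  case empty
  then show ?case by (simp add: bigomega_def)
next
  case (insert x F)
  have "(\<Prod>v\<in>F. nth_prime (f v)) > 0"
    using prime_nth_prime by (simp add: prod_pos prime_gt_0_nat)
  then show ?case
    using insert prime_gt_0_nat[OF prime_nth_prime] by (simp add: bigomega_mult bigomega_nth_prime)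
qed

lemma bigomega_pos: "n \<ge> 2 \<Longrightarrow> bigomega n > 0"
  by (auto simp: bigomega_def prime_factorization_empty_iff simp flip: neq0_conv)

section \<open>The weight of the vertices below the root, read off from a Matula number\<close>

text \<open>
  The prime factors of a Matula number stand for the branches at the root, and \<open>prime_index p\<close> is
  the Matula number of the branch belonging to \<open>p\<close>. The root of such a branch has
  \<open>bigomega (prime_index p)\<close> children and one parent.
\<close>

function nonroot_weight :: "nat \<Rightarrow> nat"
  where "nonroot_weight n =
    (\<Prod>p\<in>#prime_factorization n.
       nonroot_weight (prime_index p)
         * (1 + bigomega (prime_index p)) ^ (1 + bigomega (prime_index p)))"
  by auto
termination
proof (relation "measure id", goal_cases)
  case 1
  then show ?case by simp
next
  case (2 n p)
  then have "prime p" "p dvd n" "n > 0" by (auto simp: in_prime_factors_iff)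
  then show ?case using prime_index_less[of p] dvd_imp_le[of p n] by simp
qed

declare nonroot_weight.simps [simp del]

lemma nonroot_weight_1: "nonroot_weight 1 = 1"
  by (subst nonroot_weight.simps) simp

lemma nonroot_weight_mult:
  "a > 0 \<Longrightarrow> b > 0 \<Longrightarrow> nonroot_weight (a * b) = nonroot_weight a * nonroot_weight b"
  by (subst (1 2 3) nonroot_weight.simps) (simp add: prime_factorization_mult)

lemma nonroot_weight_nth_prime:
  "m \<ge> 1 \<Longrightarrow>
    nonroot_weight (nth_prime m) = nonroot_weight m * (1 + bigomega m) ^ (1 + bigomega m)"
  by (subst nonroot_weight.simps)
    (simp add: prime_factorization_prime prime_nth_prime prime_index_nth_prime)

lemma nonroot_weight_prod_nth_prime:
  "finite A \<Longrightarrow>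
    nonroot_weight (\<Prod>v\<in>A. nth_prime (f v)) = (\<Prod>v\<in>A. nonroot_weight (nth_prime (f v)))"
proof (induction A rule: finite_induct)
  case empty
  then show ?case using nonroot_weight_1 by simp
next
  case (insert x F)
  have "(\<Prod>v\<in>F. nth_prime (f v)) > 0"
    using prime_nth_prime by (simp add: prod_pos prime_gt_0_nat)
  then show ?case
    using insert prime_gt_0_nat[OF prime_nth_prime] by (simp add: nonroot_weight_mult)
qed

section \<open>The branches of a rooted tree\<close>

definition away_from_root :: "'a rooted_graph \<Rightarrow> ('a \<times> 'a) set"
  where "away_from_root T = {(x, y). {x, y} \<in> edges T \<and> x \<noteq> root T \<and> y \<noteq> root T}"

lemma branch_verts_away: "branch_verts T v = {u. (v, u) \<in> (away_from_root T)\<^sup>*}"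
  by (simp add: branch_verts_def away_from_root_def)

lemma sym_away_from_root: "sym (away_from_root T)"
  by (auto simp: sym_def away_from_root_def insert_commute)

lemma branch_simps [simp]:
  "verts (branch T v) = branch_verts T v"
  "edges (branch T v) = {e \<in> edges T. e \<subseteq> branch_verts T v}"
  "root (branch T v) = v"
  by (simp_all add: branch_def)

text \<open>
  Loops can be cut out of a walk: whenever a step returns to a visited point, the list is truncated
  there. This supplies the repetition-free vertex lists demanded of a cycle.
\<close>

lemma rtrancl_distinct_path:
  assumes "(a, b) \<in> R\<^sup>*"
  shows "\<exists>xs. xs \<noteq> [] \<and> hd xs = a \<and> last xs = b \<and> distinct xs \<and>
    successively (\<lambda>x y. (x, y) \<in> R) xs"
  using assms
proof (induction rule: rtrancl_induct)
  case base
  show ?case by (intro exI[of _ "[a]"]) simp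
next
  case (step b c)
  then obtain xs where xs: "xs \<noteq> []" "hd xs = a" "last xs = b" "distinct xs"
    "successively (\<lambda>x y. (x, y) \<in> R) xs" by blast
  show ?case
  proof (cases "c \<in> set xs")
    case True
    then obtain ys zs where "xs = ys @ c # zs" by (meson split_list)
    then have "xs = (ys @ [c]) @ zs" by simp
    with xs show ?thesis
      by (intro exI[of _ "ys @ [c]"]) (auto simp: successively_append_iff hd_append)
  next
    case False
    with xs step(2) show ?thesis
      by (intro exI[of _ "xs @ [c]"]) (auto simp: successively_append_iff)
  qed
qed

lemma rooted_treeD:
  assumes "rooted_tree T"
  shows "finite (verts T)" "root T \<in> verts T" "finite (edges T)"
    "\<And>e. e \<in> edges T \<Longrightarrow> e \<subseteq> verts T" "\<And>e. e \<in> edges T \<Longrightarrow> card e = 2"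
    "wf_rooted_graph T" "connected_graph T" "\<And>xs. \<not> is_cycle T xs"
proof -
  show "wf_rooted_graph T" "connected_graph T" "\<And>xs. \<not> is_cycle T xs"
    using assms by (auto simp: rooted_tree_def)
  then show *: "finite (verts T)" "root T \<in> verts T"
    "\<And>e. e \<in> edges T \<Longrightarrow> e \<subseteq> verts T" "\<And>e. e \<in> edges T \<Longrightarrow> card e = 2"
    by (auto simp: wf_rooted_graph_def)
  have "edges T \<subseteq> Pow (verts T)" using *(3) by blast
  then show "finite (edges T)" using *(1) finite_subset by blast
qed

lemma edge_endpoints:
  assumes "rooted_tree T" "{x, y} \<in> edges T"
  shows "x \<in> verts T" "y \<in> verts T" "x \<noteq> y"
  using rooted_treeD(4,5)[OF assms] by auto

lemma finite_root_neighbours: "rooted_tree T \<Longrightarrow> finite (root_neighbours T)"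
  by (rule finite_subset[of _ "verts T"])
    (auto simp: root_neighbours_def dest: edge_endpoints rooted_treeD(1))

lemma root_notin_branch:
  assumes "rooted_tree T" "v \<in> root_neighbours T"
  shows "root T \<notin> branch_verts T v"
proof
  assume "root T \<in> branch_verts T v"
  then have "(v, root T) \<in> (away_from_root T)\<^sup>*" by (simp add: branch_verts_away)
  then show False
    using edge_endpoints(3)[OF assms(1), of "root T" v] assms(2)
    by (cases rule: rtranclE) (auto simp: root_neighbours_def away_from_root_def)
qed

lemma branch_verts_closed:
  assumes "u \<in> branch_verts T v" "{u, w} \<in> edges T" "u \<noteq> root T" "w \<noteq> root T"
  shows "w \<in> branch_verts T v"
  using assms by (auto simp: branch_verts_away away_from_root_def intro: rtrancl_into_rtrancl)

lemma branch_rooted_tree: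
  assumes T: "rooted_tree T" and v: "v \<in> root_neighbours T"
  shows "rooted_tree (branch T v)"
  unfolding rooted_tree_def
proof (intro conjI notI)
  note sub = branch_verts_psubset[OF rooted_treeD(6)[OF T] v]
  show "wf_rooted_graph (branch T v)"
    using sub rooted_treeD[OF T] finite_subset[of "branch_verts T v" "verts T"]
    by (auto simp: wf_rooted_graph_def branch_verts_away)
  let ?R = "{(x, y). {x, y} \<in> edges (branch T v)}"
  have reach: "(v, u) \<in> ?R\<^sup>*" if "u \<in> branch_verts T v" for u
    using that unfolding branch_verts_away mem_Collect_eq
  proof (induction rule: rtrancl_induct)
    case base
    then show ?case by simp
  next
    case (step x y)
    then have "(x, y) \<in> ?R"
      by (auto simp: branch_verts_away away_from_root_def intro: rtrancl_into_rtrancl)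
    with step show ?case by (meson rtrancl_into_rtrancl)
  qed
  have "sym ?R" by (auto simp: sym_def insert_commute)
  then show "connected_graph (branch T v)"
    unfolding connected_graph_def using reach by (auto intro: rtrancl_trans dest: symD[OF sym_rtrancl])
  assume "\<exists>xs. is_cycle (branch T v) xs"
  then show False
    using rooted_treeD(8)[OF T] sub unfolding is_cycle_def by fastforce
qed

text \<open>
  If two branches met, a path from \<open>v\<close> to \<open>w\<close> that avoids the root would close up with the root to
  a cycle.
\<close>

lemma branches_disjoint:
  assumes T: "rooted_tree T" and v: "v \<in> root_neighbours T" and w: "w \<in> root_neighbours T"
    and "v \<noteq> w"
  shows "branch_verts T v \<inter> branch_verts T w = {}"
proof (rule ccontr)
  assume "\<not> ?thesis"
  then obtain u where "(v, u) \<in> (away_from_root T)\<^sup>*" "(w, u) \<in> (away_from_root T)\<^sup>*"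
    by (auto simp: branch_verts_away)
  then have "(v, w) \<in> (away_from_root T)\<^sup>*"
    using symD[OF sym_rtrancl[OF sym_away_from_root]] by (meson rtrancl_trans)
  then obtain xs where xs: "xs \<noteq> []" "hd xs = v" "last xs = w" "distinct xs"
    "successively (\<lambda>x y. (x, y) \<in> away_from_root T) xs"
    using rtrancl_distinct_path by metis
  have step: "(xs ! i, xs ! Suc i) \<in> away_from_root T" if "Suc i < length xs" for i
    using xs(5) that by (simp add: successively_conv_nth)
  have len: "length xs \<ge> 2"
    using xs(1-3) \<open>v \<noteq> w\<close> by (cases xs; cases "tl xs") auto
  have edge: "{root T, v} \<in> edges T" "{root T, w} \<in> edges T"
    using v w by (auto simp: root_neighbours_def)
  have mem: "x \<in> verts T \<and> x \<noteq> root T" if x: "x \<in> set xs" for x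
  proof -
    obtain i where i: "i < length xs" "x = xs ! i" using x by (auto simp: in_set_conv_nth)
    show ?thesis
    proof (cases i)
      case 0
      then have "x = v" using i xs(1,2) by (simp add: hd_conv_nth)
      then show ?thesis using edge_endpoints[OF T edge(1)] by auto
    next
      case (Suc j)
      then show ?thesis
        using step[of j] i edge_endpoints[OF T] by (auto simp: away_from_root_def)
    qed
  qed
  have "is_cycle T (root T # xs)"
    unfolding is_cycle_def
  proof (intro conjI allI impI)
    fix i assume "Suc i < length (root T # xs)"
    then show "{(root T # xs) ! i, (root T # xs) ! Suc i} \<in> edges T"
      using edge(1) step xs(1,2) by (cases i) (auto simp: away_from_root_def hd_conv_nth)
  qed (use len mem xs edge rooted_treeD(2)[OF T] in \<open>auto simp: insert_commute\<close>)
  then show False using rooted_treeD(8)[OF T] by blast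
qed

lemma branches_cover:
  assumes T: "rooted_tree T"
  shows "verts T - {root T} = (\<Union>v\<in>root_neighbours T. branch_verts T v)"
proof (intro equalityI subsetI)
  fix u assume u: "u \<in> verts T - {root T}"
  then have "(root T, u) \<in> {(x, y). {x, y} \<in> edges T}\<^sup>*"
    using rooted_treeD(2,7)[OF T] by (auto simp: connected_graph_def)
  then have "u = root T \<or> u \<in> (\<Union>v\<in>root_neighbours T. branch_verts T v)"
  proof (induction rule: rtrancl_induct)
    case (step x y)
    consider "y = root T" | "x = root T" | "x \<noteq> root T" "y \<noteq> root T" by blast
    then show ?case
    proof cases
      case 2
      then have "y \<in> root_neighbours T" "y \<in> branch_verts T y"
        using step(2) by (auto simp: root_neighbours_def branch_verts_away)
      then show ?thesis by blast
    next
      case 3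
      then show ?thesis using step branch_verts_closed by fastforce
    qed simp
  qed simp
  with u show "u \<in> (\<Union>v\<in>root_neighbours T. branch_verts T v)" by simp
next
  fix u assume "u \<in> (\<Union>v\<in>root_neighbours T. branch_verts T v)"
  then show "u \<in> verts T - {root T}"
    using branch_verts_psubset[OF rooted_treeD(6)[OF T]] root_notin_branch[OF T] by blast
qed

section \<open>Degrees in branches\<close>

lemma edge_eq_pair:
  assumes "rooted_tree T" "e \<in> edges T" "u \<in> e"
  obtains w where "e = {u, w}" "w \<noteq> u"
  using rooted_treeD(5)[OF assms(1,2)] assms(3) by (auto simp: card_2_iff)

lemma degree_root:
  assumes T: "rooted_tree T"
  shows "degree T (root T) = card (root_neighbours T)"
proof -
  have "bij_betw (\<lambda>v. {root T, v}) (root_neighbours T) {e \<in> edges T. root T \<in> e}"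
  proof (rule bij_betw_imageI)
    show "inj_on (\<lambda>v. {root T, v}) (root_neighbours T)"
      by (auto simp: inj_on_def doubleton_eq_iff)
    have "e \<in> (\<lambda>v. {root T, v}) ` root_neighbours T" if e: "e \<in> edges T" "root T \<in> e" for e
    proof -
      obtain w where "e = {root T, w}" using edge_eq_pair[OF T e] .
      with e show ?thesis by (simp add: root_neighbours_def)
    qed
    then show "(\<lambda>v. {root T, v}) ` root_neighbours T = {e \<in> edges T. root T \<in> e}"
      by (auto simp: root_neighbours_def)
  qed
  then show ?thesis by (simp add: degree_def bij_betw_same_card)
qed

lemma branch_edges_at:
  assumes T: "rooted_tree T" and v: "v \<in> root_neighbours T" and u: "u \<in> branch_verts T v"
  shows "{e \<in> edges (branch T v). u \<in> e} = {e \<in> edges T. u \<in> e \<and> root T \<notin> e}"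
proof (intro equalityI subsetI)
  fix e assume "e \<in> {e \<in> edges T. u \<in> e \<and> root T \<notin> e}"
  then have e: "e \<in> edges T" "u \<in> e" "root T \<notin> e" by auto
  obtain w where w: "e = {u, w}" using edge_eq_pair[OF T e(1,2)] by blast
  then have "w \<in> branch_verts T v" using branch_verts_closed[OF u] e by auto
  with e w u show "e \<in> {e \<in> edges (branch T v). u \<in> e}" by simp
qed (use root_notin_branch[OF T v] in auto)

text \<open>
  The only edge at a vertex of a branch that is lost when the root is removed is the one
  joining \<open>v\<close> to the root: another edge from the branch to the root would make its endpoint
  a second root neighbour with an overlapping branch.
\<close>

lemma degree_branch:
  assumes T: "rooted_tree T" and v: "v \<in> root_neighbours T" and u: "u \<in> branch_verts T v"
  shows "degree T u = degree (branch T v) u + (if u = v then 1 else 0)"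
proof -
  let ?far = "{e \<in> edges T. u \<in> e \<and> root T \<notin> e}"
  let ?near = "{e \<in> edges T. u \<in> e \<and> root T \<in> e}"
  have neq: "u \<noteq> root T" using root_notin_branch[OF T v] u by auto
  have near: "u = v \<and> e = {root T, v}" if e: "e \<in> edges T" "u \<in> e" "root T \<in> e" for e
  proof -
    obtain w where "e = {root T, w}" using edge_eq_pair[OF T e(1,3)] .
    then have eq: "e = {root T, u}" using e(2) neq by auto
    then have "u \<in> root_neighbours T" using e by (simp add: root_neighbours_def)
    moreover have "u \<in> branch_verts T u" by (simp add: branch_verts_away)
    ultimately have "u = v" using branches_disjoint[OF T v] u by blast
    with eq show ?thesis by simp
  qed
  have "card ?near = (if u = v then 1 else 0)"
  proof (cases "u = v")
    case True
    have "{root T, v} \<in> edges T" using v by (simp add: root_neighbours_def)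
    with True near have "?near = {{root T, v}}" by blast
    with True show ?thesis by simp
  next
    case False
    with near have "?near = {}" by blast
    then have "card ?near = 0" by (simp only: card.empty)
    with False show ?thesis by simp
  qed
  moreover have "card {e \<in> edges T. u \<in> e} = card (?far \<union> ?near)"
    by (rule arg_cong[where f = card]) blast
  moreover have "card (?far \<union> ?near) = card ?far + card ?near"
    using rooted_treeD(3)[OF T] by (intro card_Un_disjoint) auto
  ultimately show ?thesis
    unfolding degree_def branch_edges_at[OF assms] by linarith
qed

section \<open>The index of a tree is a function of its Matula number\<close>

lemma matula_tree:
  "rooted_tree T \<Longrightarrow> matula T = (\<Prod>v\<in>root_neighbours T. nth_prime (matula (branch T v)))"
  by (subst matula.simps) simp

lemma matula_pos: "rooted_tree T \<Longrightarrow> matula T \<ge> 1"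
  using prime_gt_0_nat[OF prime_nth_prime] by (simp add: matula_tree prod_pos Suc_leI)

lemma degree_root_matula: "rooted_tree T \<Longrightarrow> degree T (root T) = bigomega (matula T)"
  by (simp add: matula_tree bigomega_prod_nth_prime finite_root_neighbours degree_root)

text \<open>
  Induction over branches. The vertex \<open>v\<close> heading a branch counts as a root in the branch
  and as an ordinary vertex of degree one higher in the whole tree, which is exactly the extra
  factor in the recursion of \<open>nonroot_weight\<close>.
\<close>

lemma nonroot_weight_matula:
  assumes "rooted_tree T"
  shows "(\<Prod>v\<in>verts T - {root T}. degree T v ^ degree T v) = nonroot_weight (matula T)"
  using assms
proof (induction "card (verts T)" arbitrary: T rule: less_induct)
  case less
  note T = less.prems
  let ?w = "\<lambda>G v. degree G v ^ degree G v"
  have branch: "prod (?w T) (branch_verts T v) = nonroot_weight (nth_prime (matula (branch T v)))"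
    if v: "v \<in> root_neighbours T" for v
  proof -
    let ?B = "branch T v"
    have B: "rooted_tree ?B" using branch_rooted_tree[OF T v] .
    have "card (verts ?B) < card (verts T)"
      using branch_verts_psubset[OF rooted_treeD(6)[OF T] v] rooted_treeD(1)[OF T]
      by (simp add: psubset_card_mono)
    then have IH: "prod (?w ?B) (branch_verts T v - {v}) = nonroot_weight (matula ?B)"
      using less.hyps[of ?B] B by simp
    have vB: "v \<in> branch_verts T v" and fin: "finite (branch_verts T v)"
      using rooted_treeD(1,2)[OF B] by simp_all
    have "prod (?w T) (branch_verts T v) = ?w T v * prod (?w T) (branch_verts T v - {v})"
      using prod.remove[OF fin vB] .
    also have "prod (?w T) (branch_verts T v - {v}) = prod (?w ?B) (branch_verts T v - {v})"
      by (rule prod.cong) (auto simp: degree_branch[OF T v])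
    also have "degree T v = 1 + bigomega (matula ?B)"
      using degree_branch[OF T v vB] degree_root_matula[OF B] by simp
    finally show ?thesis
      using IH matula_pos[OF B] by (simp add: nonroot_weight_nth_prime)
  qed
  have "prod (?w T) (verts T - {root T}) =
      (\<Prod>v\<in>root_neighbours T. prod (?w T) (branch_verts T v))"
    unfolding branches_cover[OF T]
  proof (intro prod.UNION_disjoint ballI impI)
    show "finite (branch_verts T v)" if "v \<in> root_neighbours T" for v
      using rooted_treeD(1)[OF branch_rooted_tree[OF T that]] by simp
  qed (use finite_root_neighbours[OF T] branches_disjoint[OF T] in blast)+
  also have "\<dots> = nonroot_weight (matula T)"
    using branch by (simp add: matula_tree[OF T] nonroot_weight_prod_nth_prime finite_root_neighbours[OF T])
  finally show ?case .
qed

text \<open>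
  Double counting of the incident pairs of an edge and a vertex.
\<close>

lemma prod_edges_eq_prod_verts:
  fixes f :: "'a \<Rightarrow> nat"
  assumes "wf_rooted_graph G"
  shows "(\<Prod>e\<in>edges G. \<Prod>i\<in>e. f i) = (\<Prod>i\<in>verts G. f i ^ degree G i)"
proof -
  have V: "finite (verts G)" "\<And>e. e \<in> edges G \<Longrightarrow> e \<subseteq> verts G"
    using assms by (auto simp: wf_rooted_graph_def)
  have E: "finite (edges G)"
    by (rule finite_subset[of _ "Pow (verts G)"]) (use V in auto)
  have "(\<Prod>e\<in>edges G. \<Prod>i\<in>e. f i) = (\<Prod>e\<in>edges G. \<Prod>i\<in>verts G. if i \<in> e then f i else 1)"
  proof (rule prod.cong[OF refl])
    fix e assume "e \<in> edges G"
    then have "verts G \<inter> e = e" using V by blast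
    then show "prod f e = (\<Prod>i\<in>verts G. if i \<in> e then f i else 1)"
      using prod.inter_restrict[OF V(1), of f e] by simp
  qed
  also have "\<dots> = (\<Prod>i\<in>verts G. \<Prod>e\<in>edges G. if i \<in> e then f i else 1)"
    by (rule prod.swap)
  also have "\<dots> = (\<Prod>i\<in>verts G. f i ^ degree G i)"
    using E by (simp add: degree_def prod.inter_filter[symmetric])
  finally show ?thesis .
qed

lemma matula_eq_1_iff:
  assumes T: "rooted_tree T"
  shows "matula T = 1 \<longleftrightarrow> card (verts T) = 1"
proof
  assume "matula T = 1"
  then have "degree T (root T) = 0" by (simp add: degree_root_matula[OF T] bigomega_def)
  then have "root_neighbours T = {}"
    using finite_root_neighbours[OF T] by (simp add: degree_root[OF T])
  then have "verts T = {root T}"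
    using branches_cover[OF T] rooted_treeD(2)[OF T] by auto
  then show "card (verts T) = 1" by simp
next
  assume "card (verts T) = 1"
  then obtain x where x: "verts T = {x}" by (rule card_1_singletonE)
  have "v \<notin> root_neighbours T" for v
    using edge_endpoints[OF T, of "root T" v] x by (auto simp: root_neighbours_def)
  then have "root_neighbours T = {}" by blast
  then show "matula T = 1" by (simp add: matula_tree[OF T])
qed

text \<open>
  For the one-vertex tree the product over vertices is \<open>0 ^ 0 = 1\<close>, so the conventional value \<open>0\<close>
  has to be split off.
\<close>

lemma zagreb2_matula:
  assumes T: "rooted_tree T"
  shows "zagreb2 T = (if matula T = 1 then 0
    else nonroot_weight (matula T) * bigomega (matula T) ^ bigomega (matula T))"
proof -
  have "(\<Prod>e\<in>edges T. \<Prod>i\<in>e. degree T i) =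
      degree T (root T) ^ degree T (root T) * nonroot_weight (matula T)"
    using rooted_treeD[OF T]
    by (simp add: prod_edges_eq_prod_verts prod.remove[of _ "root T"] nonroot_weight_matula[OF T])
  then show ?thesis
    using matula_eq_1_iff[OF T] by (simp add: zagreb2_def degree_root_matula[OF T])
qed

section \<open>Every positive integer is a Matula number\<close>

text \<open>
  Joining the roots of \<open>A\<close> and \<open>B\<close> by an edge and keeping the root of \<open>B\<close> adds \<open>A\<close> to the branches
  of \<open>B\<close>. Every tree with at least two vertices is built in this way from smaller ones.
\<close>

definition graft :: "'a rooted_graph \<Rightarrow> 'a rooted_graph \<Rightarrow> 'a rooted_graph"
  where "graft A B =
    \<lparr>verts = verts A \<union> verts B, edges = insert {root A, root B} (edges A \<union> edges B), root = root B\<rparr>"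

lemma graft_simps [simp]:
  "verts (graft A B) = verts A \<union> verts B"
  "edges (graft A B) = insert {root A, root B} (edges A \<union> edges B)"
  "root (graft A B) = root B"
  by (simp_all add: graft_def)

text \<open>
  Indices modulo the length treat the closing edge of a cycle like all others.
\<close>

lemma cycle_edge_mod:
  assumes "is_cycle G xs" "i < length xs"
  shows "{xs ! i, xs ! (Suc i mod length xs)} \<in> edges G"
proof (cases "Suc i < length xs")
  case True
  then show ?thesis using assms by (simp add: is_cycle_def)
next
  case False
  then have i: "Suc i = length xs" using assms by simp
  then have "xs ! i = last xs" "xs ! 0 = hd xs"
    using assms(2) by (metis last_conv_nth diff_Suc_1 list.size(3) not_less_zero,
      metis hd_conv_nth list.size(3) not_less_zero)
  then show ?thesis using assms i by (simp add: is_cycle_def)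
qed

text \<open>
  Otherwise truth would spread step by step from \<open>i\<close> around the cycle to \<open>j\<close>.
\<close>

lemma cyclic_descent:
  fixes P :: "nat \<Rightarrow> bool"
  assumes "i < n" "P i" "j < n" "\<not> P j"
  shows "\<exists>k<n. P k \<and> \<not> P (Suc k mod n)"
proof (rule ccontr)
  assume "\<not> ?thesis"
  then have *: "P (Suc k mod n)" if "k < n" "P k" for k using that by blast
  have "P ((i + k) mod n)" for k
  proof (induction k)
    case 0
    then show ?case using assms by simp
  next
    case (Suc k)
    then show ?case using *[of "(i + k) mod n"] assms(1) by (simp add: mod_Suc_eq)
  qed
  from this[of "n - i + j"] show False using assms by simp
qed

text \<open>
  A cycle meeting both \<open>S\<close> and its complement leaves \<open>S\<close> and enters it again. If \<open>{a, b}\<close> is the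
  only edge crossing the cut, both crossings use it, so \<open>a\<close> follows \<open>b\<close> and \<open>b\<close> follows \<open>a\<close>, which
  leaves no room for a third vertex.
\<close>

lemma bridge_not_on_cycle:
  assumes cyc: "is_cycle G xs" and "S \<inter> set xs \<noteq> {}" "\<not> set xs \<subseteq> S"
    and cut: "\<And>x y. {x, y} \<in> edges G \<Longrightarrow> x \<in> S \<Longrightarrow> y \<notin> S \<Longrightarrow> x = a \<and> y = b"
  shows False
proof -
  let ?n = "length xs" and ?P = "\<lambda>i. xs ! i \<in> S"
  have n: "?n \<ge> 3" "distinct xs" using cyc by (auto simp: is_cycle_def)
  obtain i j where ij: "i < ?n" "?P i" "j < ?n" "\<not> ?P j"
    using assms(2,3) by (auto simp: in_set_conv_nth)
  obtain k where k: "k < ?n" "?P k" "\<not> ?P (Suc k mod ?n)"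
    using cyclic_descent[of i ?n ?P j] ij by blast
  obtain l where l: "l < ?n" "\<not> ?P l" "?P (Suc l mod ?n)"
    using cyclic_descent[of j ?n "\<lambda>i. \<not> ?P i" i] ij by blast
  have "xs ! k = a" "xs ! (Suc k mod ?n) = b"
    using cut[OF cycle_edge_mod[OF cyc k(1)]] k by auto
  moreover have "xs ! (Suc l mod ?n) = a" "xs ! l = b"
    using cut[of "xs ! (Suc l mod ?n)" "xs ! l"] cycle_edge_mod[OF cyc l(1)] l
    by (auto simp: insert_commute)
  moreover have "Suc k mod ?n < ?n" "Suc l mod ?n < ?n"
    using n(1) by (auto intro!: mod_less_divisor)
  ultimately have "Suc l mod ?n = k" "Suc k mod ?n = l"
    using nth_eq_iff_index_eq[OF n(2)] k(1) l(1) by blast+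
  then show False using n(1) k(1) l(1) by (auto simp: mod_Suc split: if_splits)
qed

lemma graft_rooted_tree:
  assumes A: "rooted_tree A" and B: "rooted_tree B" and dis: "verts A \<inter> verts B = {}"
  shows "rooted_tree (graft A B)"
  unfolding rooted_tree_def
proof (intro conjI notI)
  let ?C = "graft A B"
  note dA = rooted_treeD[OF A] and dB = rooted_treeD[OF B]
  have neq: "root A \<noteq> root B" using dA(2) dB(2) dis by auto
  show "wf_rooted_graph ?C"
    using dA(1-5) dB(1-5) neq by (auto simp: wf_rooted_graph_def)
  let ?R = "\<lambda>G. {(x, y). {x, y} \<in> edges G}"
  have sub: "(?R A)\<^sup>* \<subseteq> (?R ?C)\<^sup>*" "(?R B)\<^sup>* \<subseteq> (?R ?C)\<^sup>*"
    by (rule rtrancl_mono, force)+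
  have to_root: "(root B, u) \<in> (?R ?C)\<^sup>*" if "u \<in> verts ?C" for u
  proof (cases "u \<in> verts B")
    case True
    then show ?thesis using dB(2,7) sub(2) unfolding connected_graph_def by blast
  next
    case False
    then have "(root A, u) \<in> (?R ?C)\<^sup>*"
      using that dA(2,7) sub(1) unfolding connected_graph_def by auto
    moreover have "(root B, root A) \<in> ?R ?C" by (simp add: insert_commute)
    ultimately show ?thesis by (rule converse_rtrancl_into_rtrancl[rotated])
  qed
  have "sym (?R ?C)" by (auto simp: sym_def insert_commute)
  then show "connected_graph ?C"
    unfolding connected_graph_def using to_root by (meson rtrancl_trans symD[OF sym_rtrancl])
  assume "\<exists>xs. is_cycle ?C xs"
  then obtain xs where xs: "is_cycle ?C xs" by blast
  have inA: "{x, y} \<in> edges A" if "{x, y} \<in> edges ?C" "x \<in> verts A" "y \<in> verts A" for x y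
    using that dB(2) dB(4)[of "{x, y}"] dis by (auto simp: doubleton_eq_iff)
  have inB: "{x, y} \<in> edges B" if "{x, y} \<in> edges ?C" "x \<in> verts B" "y \<in> verts B" for x y
    using that dA(2) dA(4)[of "{x, y}"] dis by (auto simp: doubleton_eq_iff)
  have ne: "xs \<noteq> []" using xs by (auto simp: is_cycle_def)
  \<comment> \<open>A cycle lies in one of the two trees or crosses the joining edge.\<close>
  consider "set xs \<subseteq> verts A" | "verts A \<inter> set xs = {}"
    | "verts A \<inter> set xs \<noteq> {}" "\<not> set xs \<subseteq> verts A" by blast
  then show False
  proof cases
    case 1
    then have "is_cycle A xs"
      using xs ne inA unfolding is_cycle_def by (auto simp del: graft_simps simp: subset_iff)
    then show False using dA(8) by blast
  next
    case 2
    then have "set xs \<subseteq> verts B" using xs by (auto simp: is_cycle_def)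
    then have "is_cycle B xs"
      using xs ne inB unfolding is_cycle_def by (auto simp del: graft_simps simp: subset_iff)
    then show False using dB(8) by blast
  next
    case 3
    have "x = root A \<and> y = root B" if "{x, y} \<in> edges ?C" "x \<in> verts A" "y \<notin> verts A" for x y
      using that dA(2) dB(2) dA(4)[of "{x, y}"] dB(4)[of "{x, y}"] dis
      by (auto simp: doubleton_eq_iff)
    then show False using bridge_not_on_cycle[OF xs 3] by blast
  qed
qed

lemma matula_graft:
  assumes A: "rooted_tree A" and B: "rooted_tree B" and dis: "verts A \<inter> verts B = {}"
  shows "matula (graft A B) = nth_prime (matula A) * matula B"
proof -
  let ?C = "graft A B"
  note dA = rooted_treeD[OF A] and dB = rooted_treeD[OF B]
  have neq: "root A \<noteq> root B" using dA(2) dB(2) dis by auto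
  have EA: "x \<noteq> root B" "y \<noteq> root B" if "{x, y} \<in> edges A" for x y
    using edge_endpoints[OF A that] dB(2) dis by auto
  have nb: "root_neighbours ?C = insert (root A) (root_neighbours B)"
    using EA neq by (auto simp: root_neighbours_def doubleton_eq_iff)
  have notin: "root A \<notin> root_neighbours B"
    using edge_endpoints[OF B] dA(2) dis by (auto simp: root_neighbours_def)
  have away: "away_from_root ?C = {(x, y). {x, y} \<in> edges A} \<union> away_from_root B"
    using EA by (auto simp: away_from_root_def doubleton_eq_iff)
  have "branch_verts ?C (root A) = verts A"
  proof (intro equalityI subsetI)
    fix u assume "u \<in> verts A"
    then have "(root A, u) \<in> {(x, y). {x, y} \<in> edges A}\<^sup>*"
      using dA(2,7) by (simp add: connected_graph_def)
    then show "u \<in> branch_verts ?C (root A)"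
      by (simp add: branch_verts_away away in_rtrancl_UnI)
  next
    fix u assume "u \<in> branch_verts ?C (root A)"
    then have "(root A, u) \<in> (away_from_root ?C)\<^sup>*" by (simp add: branch_verts_away)
    then show "u \<in> verts A"
    proof (induction rule: rtrancl_induct)
      case (step x y)
      then show ?case
        using edge_endpoints[OF A] edge_endpoints[OF B] dis
        unfolding away by (auto simp: away_from_root_def)
    qed (use dA(2) in simp)
  qed
  moreover have "{e \<in> edges ?C. e \<subseteq> verts A} = edges A"
  proof -
    have "\<not> e \<subseteq> verts A" if "e \<in> edges B" for e
      using dB(4,5)[OF that] dis by (auto simp: card_2_iff)
    then show ?thesis using dA(4) dB(2) dis by auto
  qed
  ultimately have brA: "branch ?C (root A) = A"
    by (simp add: branch_def del: graft_simps)
  have brB: "branch ?C v = branch B v" if v: "v \<in> root_neighbours B" for v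
  proof -
    have vB: "v \<in> verts B" using v edge_endpoints[OF B] by (auto simp: root_neighbours_def)
    have "u \<in> verts B \<and> (v, u) \<in> (away_from_root B)\<^sup>*" if "(v, u) \<in> (away_from_root ?C)\<^sup>*" for u
      using that
    proof (induction rule: rtrancl_induct)
      case (step x y)
      then have "{x, y} \<notin> edges A" using edge_endpoints(1)[OF A, of x y] dis by blast
      with step(2) have "(x, y) \<in> away_from_root B" unfolding away by blast
      with step show ?case
        using edge_endpoints[OF B] by (auto simp: away_from_root_def intro: rtrancl_into_rtrancl)
    qed (use vB in simp)
    moreover have "(away_from_root B)\<^sup>* \<subseteq> (away_from_root ?C)\<^sup>*"
      unfolding away by (rule rtrancl_mono) simp
    ultimately have bv: "branch_verts ?C v = branch_verts B v" "branch_verts B v \<subseteq> verts B"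
      unfolding branch_verts_away by auto
    moreover have "{e \<in> edges ?C. e \<subseteq> branch_verts B v} = {e \<in> edges B. e \<subseteq> branch_verts B v}"
    proof -
      have "\<not> e \<subseteq> verts B" if "e \<in> edges A" for e
        using dA(4,5)[OF that] dis by (auto simp: card_2_iff)
      then show ?thesis using dA(2) bv(2) dis by auto
    qed
    ultimately show ?thesis by (simp add: branch_def del: graft_simps)
  qed
  show ?thesis
    using graft_rooted_tree[OF assms] finite_root_neighbours[OF B] notin brA brB
    by (simp add: matula_tree B nb)
qed

text \<open>
  Splitting off a prime factor \<open>p\<^sub>k\<close> from \<open>n\<close> splits off a branch with Matula number \<open>k\<close>. The
  statement allows any finite set of vertices to be avoided, so that the induction
  hypothesis delivers disjoint trees and no vertices have to be renamed.
\<close>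

lemma matula_surj:
  assumes "n \<ge> 1" "infinite (UNIV :: 'a set)" "finite (X :: 'a set)"
  shows "\<exists>T :: 'a rooted_graph. rooted_tree T \<and> matula T = n \<and> verts T \<inter> X = {}"
  using assms(1,3)
proof (induction n arbitrary: X rule: less_induct)
  case (less n)
  show ?case
  proof (cases "n = 1")
    case True
    obtain a where a: "a \<notin> X" using ex_new_if_finite[OF assms(2) less.prems(2)] by blast
    let ?T = "\<lparr>verts = {a}, edges = {}, root = a\<rparr>"
    have T: "rooted_tree ?T"
      by (auto simp: rooted_tree_def wf_rooted_graph_def connected_graph_def is_cycle_def)
    then have "matula ?T = 1" using matula_eq_1_iff by fastforce
    with T a True show ?thesis by (intro exI[of _ ?T]) simp
  next
    case False
    then obtain p where p: "prime p" "p dvd n" using prime_factor_nat by blast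
    then obtain m where m: "n = p * m" by blast
    obtain k where k: "k \<ge> 1" "nth_prime k = p" using nth_prime_surj[OF p(1)] .
    have "k < n"
      using less_nth_prime[of k] k(2) dvd_imp_le[OF p(2)] less.prems(1) by simp
    have "m \<ge> 1" "m < n"
      using m less.prems(1) prime_gt_1_nat[OF p(1)] by auto
    then obtain B where B: "rooted_tree B" "matula B = m" "verts B \<inter> X = {}"
      using less.IH[of m X] less.prems(2) by blast
    then have "finite (X \<union> verts B)" using less.prems(2) rooted_treeD(1) by blast
    then obtain A where A: "rooted_tree A" "matula A = k" "verts A \<inter> (X \<union> verts B) = {}"
      using less.IH[of k "X \<union> verts B"] \<open>k < n\<close> k(1) by blast
    then have "verts A \<inter> verts B = {}" by blast
    then show ?thesis
      using graft_rooted_tree matula_graft A B k m by (intro exI[of _ "graft A B"]) auto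
  qed
qed

lemma tau_rooted_tree:
  assumes "n \<ge> 1"
  shows "rooted_tree (tau n)" "matula (tau n) = n"
proof -
  have "\<exists>T :: nat rooted_graph. rooted_tree T \<and> matula T = n"
    using matula_surj[OF assms, where ?'a = nat and X = "{}"] by auto
  from someI_ex[OF this] show "rooted_tree (tau n)" "matula (tau n) = n"
    unfolding tau_def by auto
qed

section \<open>The recursion for the index\<close>

lemma MZ2_eq:
  "n \<ge> 1 \<Longrightarrow> MZ2 n = (if n = 1 then 0 else nonroot_weight n * bigomega n ^ bigomega n)"
  by (simp add: MZ2_def zagreb2_matula tau_rooted_tree)

theorem proposition3p23:
  fixes n :: nat
  assumes "n \<ge> 1"
  shows "(n = 1 \<longrightarrow> MZ2 n = 0) \<and>
    (n = 2 \<longrightarrow> MZ2 n = 1) \<and>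
    (\<forall>t::nat. t \<ge> 2 \<and> n = nth_prime t \<longrightarrow>
      real (MZ2 n) =
        real (MZ2 t) / real (bigomega t) ^ bigomega t
          * (1 + real (bigomega t)) ^ (1 + bigomega t)) \<and>
    (\<forall>r s::nat. r \<ge> 2 \<and> s \<ge> 2 \<and> n = r * s \<longrightarrow>
      real (MZ2 n) =
        real (MZ2 r) * real (MZ2 s) * real (bigomega n) ^ bigomega n
          / (real (bigomega r) ^ bigomega r * real (bigomega s) ^ bigomega s))"
proof (intro conjI allI impI)
  assume "n = 1"
  then show "MZ2 n = 0" by (simp add: MZ2_eq)
next
  assume n: "n = 2"
  obtain m where m: "m \<ge> 1" "nth_prime m = 2" using nth_prime_surj[OF two_is_prime_nat] .
  then have "m = 1" using less_nth_prime[of m] by simp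
  then have "nonroot_weight 2 = 1"
    using nonroot_weight_nth_prime[of 1] nonroot_weight_1 m by (simp add: bigomega_def)
  moreover have "bigomega 2 = 1" using bigomega_nth_prime[of m] m by simp
  ultimately show "MZ2 n = 1" using n by (simp add: MZ2_eq)
next
  fix t assume t: "t \<ge> 2 \<and> n = nth_prime t"
  have "n \<ge> 2" using t prime_ge_2_nat[OF prime_nth_prime] by simp
  then show "real (MZ2 n) = real (MZ2 t) / real (bigomega t) ^ bigomega t
      * (1 + real (bigomega t)) ^ (1 + bigomega t)"
    using t bigomega_pos[of t] bigomega_nth_prime[of t]
    by (simp add: MZ2_eq nonroot_weight_nth_prime distrib_right)
next
  fix r s assume rs: "r \<ge> 2 \<and> s \<ge> 2 \<and> n = r * s"
  then have "nonroot_weight n = nonroot_weight r * nonroot_weight s"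
    by (simp add: nonroot_weight_mult)
  moreover have "n \<noteq> 1" using rs by auto
  ultimately show "real (MZ2 n) = real (MZ2 r) * real (MZ2 s) * real (bigomega n) ^ bigomega n
      / (real (bigomega r) ^ bigomega r * real (bigomega s) ^ bigomega s)"
    using rs assms bigomega_pos[of r] bigomega_pos[of s] by (simp add: MZ2_eq del: One_nat_def)
qed

end
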